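(* Let $\mu$ be an infinite regular cardinal, and let $\mathcal{K}_1=(\mathbf{K},\preccurlyeq_1)$ and $\mathcal{K}_2=(\mathbf{K},\preccurlyeq_2)$ be $\mu$-AECs (with the same class of models $\mathbf{K}$) such that $\preccurlyeq_1$ refines $\preccurlyeq_2$, i.e. $M\preccurlyeq_2 N$ implies $M\preccurlyeq_1 N$ for all $M,N\in\mathbf{K}$. Let $\lambda$ be an infinite cardinal with $\lambda=\lambda^{<\mu}+\mathrm{LS}_\mu(\mathcal{K}_2)$ and suppose that $\mathcal{K}_2$ is almost $\lambda$-stable. Then $\mathcal{K}_1$ is almost $\lambda$-stable. In particular, if in addition $\mathcal{K}_1$ has $\infty$-AP, then $\mathcal{K}_1$ is $\lambda$-stable.
   Context: Abstract classes. An abstract class (AC) is a pair $\mathcal{K}=(\mathbf{K},\preccurlyeq)$ where $\mathbf{K}$ is a non-empty class of structures in a fixed language $\tau=\tau_{\mathcal{K}}$ and $\preccurlyeq$ is a reflexive transitive relation on $\mathbf{K}$ such that $M\preccurlyeq N$ implies $M\leq N$ ($M$ is a substructure of $N$), closed under isomorphism: if $f:N\to N'$ is an isomorphism and $N\in\mathbf{K}$ then $N'\in\mathbf{K}$, and if moreover $M\in\mathbf{K}$ and $M\preccurlyeq N$ then $f(M)\in\mathbf{K}$ and $f(M)\preccurlyeq N'$. A $\mathcal{K}$-embedding is an embedding $f:M\to N$ with $M,N\in\mathbf{K}$ and $f(M)\preccurlyeq N$. $\mu$-AECs. Let $\mu$ be an infinite regular cardinal. A poset is $\mu$-directed if each subset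 of cardinality $<\mu$ has an upper bound. A $\mu$-directed system in $\mathcal{K}$ is a family $(M_i\mid i\in I)$ of members of $\mathbf{K}$ with $I$ a $\mu$-directed poset and $M_i\preccurlyeq M_j$ whenever $i<j$. An AC $\mathcal{K}$ is a $\mu$-AEC if: (coherence) $M_0,M_1,M_2\in\mathbf{K}$, $M_0\preccurlyeq M_2$ and $M_0\leq M_1\preccurlyeq M_2$ imply $M_0\preccurlyeq M_1$; ($\mu$-continuity) for each $\mu$-directed system $(M_i)_{i\in I}$ in $\mathcal{K}$, $M=\bigcup_i M_i\in\mathbf{K}$ and $M_i\preccurlyeq M$ for all $i$; ($\mu$-smoothness) if $N\in\mathbf{K}$ and $(M_i)_{i\in I}$ is a $\mu$-directed system in $\mathcal{K}$ with all $M_i\preccurlyeq N$ and $M=\bigcup_i M_i\in\mathbf{K}$, then $M\preccurlyeq N$; (Löwenheim-Skolem) there is a cardinal $\theta=\theta^{<\mu}\geq|\tau|+\mu$ such that for all $M\in\mathbf{K}$ and $A\subseteq M$ there is $M_0\in\mathbf{K}$ with $A\subseteq M_0\preccurlyeq M$ and $|M_0|\leq|A|^{<\mu}+\theta$. The least such $\theta$ is $\mathrm{LS}_\mu(\mathcal{K})$. Here $\theta^{<\mu}=\sup\{\theta^{\eta}\mid\eta<\mu\}$. Orbital types. For triples $(b_\ell,A,N_\ell)$ with $A\subseteq N_\ell\in\mathbf{K}$ and $b_\ell\in N_\ell$ ($\ell=1,2$), put $(b_1,A,N_1)E^{\mathrm{at}}(b_2,A,N_2)$ if there are $\mathcal{K}$-embeddings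 $f_\ell:N_\ell\to N$ with $f_1(b_1)=f_2(b_2)$ and $f_1\restriction A=f_2\restriction A=\mathrm{id}_A$; let $E$ be the transitive closure of $E^{\mathrm{at}}$, and let $\mathrm{ortp}(b/A;N)$ be the $E$-class of $(b,A,N)$. For $M\preccurlyeq N$ let $\mathcal{S}(M;N)=\{\mathrm{ortp}(c/M;N)\mid c\in N\}$, and let $\mathcal{S}(M)=\bigcup_{M\preccurlyeq N\in\mathbf{K}}\mathcal{S}(M;N)$. Stability. $\mathcal{K}$ is $\lambda$-stable if $|\mathcal{S}(M)|\leq\lambda$ for each $M\in\mathbf{K}$ with $|M|=\lambda$. $\mathcal{K}$ is almost $\lambda$-stable if $|\mathcal{S}(M;N)|\leq\lambda$ for all $M\preccurlyeq N$ in $\mathbf{K}$ with $|M|=\lambda$. Amalgamation. $\mathcal{K}$ has $\infty$-AP if for every (set-indexed) collection of $\mathcal{K}$-embeddings $(f_i:M\to M_i\mid i\in I)$ there are $N\in\mathbf{K}$ and $\mathcal{K}$-embeddings $g_i:M_i\to N$ with $g_if_i=g_jf_j$ for all $i,j\in I$. *)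

theory Defs
  imports Main "HOL-Library.FuncSet"
begin

unbundle cardinal_syntax

(* HOL has no proper classes of sets, so the set-theoretic universe is played by a type 'u:
   structures have their points in 'u, and a set counts as an element of the universe iff it
   has fewer points than 'u ("small").  A class of structures is then an arbitrary HOL set of
   small structures.  When |UNIV :: 'u set| is strongly inaccessible this is, up to
   isomorphism, the usual reading of sets and classes in V_kappa for kappa = |'u|; none of the
   definitions requires inaccessibility. *)

definition small :: "'u set \<Rightarrow> bool" where
  "small A \<longleftrightarrow> |A| <o |UNIV :: 'u set|"


section \<open>Cardinal arithmetic\<close>

definition is_card_sup :: "'a rel set \<Rightarrow> 'a rel \<Rightarrow> bool" where
  "is_card_sup S k \<longleftrightarrow> Card_order k \<and> (\<forall>r\<in>S. r \<le>o k) \<and>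
     (\<forall>k' :: 'a rel. Card_order k' \<and> (\<forall>r\<in>S. r \<le>o k') \<longrightarrow> k \<le>o k')"

(* k^{<mu} = sup {k^eta | eta < mu}, eta ranging over cardinals.  Up to =o, every cardinal
   below mu lives on the type of mu. *)
definition cexp_less :: "'a rel \<Rightarrow> 'm rel \<Rightarrow> ('m \<Rightarrow> 'a) rel" where
  "cexp_less k mu = (SOME s. is_card_sup {k ^c eta |eta :: 'm rel. Card_order eta \<and> eta <o mu} s)"

lemma card_sup_exists: "\<exists>k. is_card_sup (S :: 'a rel set) k" if S: "\<And>r. r \<in> S \<Longrightarrow> Card_order r"
proof -
  define U where "U = {k :: 'a rel. Card_order k \<and> (\<forall>r\<in>S. r \<le>o k)}"
  have "r \<le>o |UNIV :: 'a set|" if "r \<in> S" for r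
    using S[OF that] card_of_Field_ordIso card_of_mono1[of "Field r" UNIV]
    by (metis ordIso_ordLeq_trans ordIso_symmetric subset_UNIV)
  then have "|UNIV :: 'a set| \<in> U"
    by (auto simp: U_def card_of_Card_order)
  then obtain k where k: "k \<in> U" and min: "\<And>k'. (k', k) \<in> ordLess \<Longrightarrow> k' \<notin> U"
    by (rule wfE_min[OF wf_ordLess]) blast
  have "k \<le>o k'" if "k' \<in> U" for k'
  proof -
    have "Well_order k" "Well_order k'"
      using k that by (auto simp: U_def card_order_on_def)
    then show ?thesis
      using min that not_ordLess_iff_ordLeq by blast
  qed
  then show ?thesis
    using k by (auto simp: U_def is_card_sup_def)
qed

lemma cexp_less_is_card_sup:
  "is_card_sup {k ^c eta |eta :: 'm rel. Card_order eta \<and> eta <o mu} (cexp_less k (mu :: 'm rel))"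
  unfolding cexp_less_def
  by (rule someI_ex, rule card_sup_exists) (auto simp: Card_order_cexp)


section \<open>Structures\<close>

(* Arities are arbitrary sets of argument positions; an argument tuple is a function on the
   set of positions.  In the definition of mu-AECs the arities are normally taken to be < mu;
   this bound is not imposed. *)
record ('f, 'r, 'i) language =
  fun_syms :: "'f set"
  rel_syms :: "'r set"
  fun_ar :: "'f \<Rightarrow> 'i set"
  rel_ar :: "'r \<Rightarrow> 'i set"

record ('u, 'f, 'r, 'i) model =
  univ :: "'u set"
  fun_int :: "'f \<Rightarrow> ('i \<Rightarrow> 'u) \<Rightarrow> 'u"
  rel_int :: "'r \<Rightarrow> ('i \<Rightarrow> 'u) set"

(* The extensional function spaces make HOL equality of structures coincide with equality of
   universes and of all interpretations. *)
definition is_struct :: "('f, 'r, 'i) language \<Rightarrow> ('u, 'f, 'r, 'i) model \<Rightarrow> bool" where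
  "is_struct L M \<longleftrightarrow> small (univ M) \<and>
     fun_int M \<in> (\<Pi>\<^sub>E F \<in> fun_syms L. (fun_ar L F \<rightarrow>\<^sub>E univ M) \<rightarrow>\<^sub>E univ M) \<and>
     rel_int M \<in> (\<Pi>\<^sub>E R \<in> rel_syms L. Pow (rel_ar L R \<rightarrow>\<^sub>E univ M))"

definition substruct ::
  "('f, 'r, 'i) language \<Rightarrow> ('u, 'f, 'r, 'i) model \<Rightarrow> ('u, 'f, 'r, 'i) model \<Rightarrow> bool" where
  "substruct L M N \<longleftrightarrow> univ M \<subseteq> univ N \<and>
     (\<forall>F\<in>fun_syms L. \<forall>xs \<in> fun_ar L F \<rightarrow>\<^sub>E univ M. fun_int M F xs = fun_int N F xs) \<and>
     (\<forall>R\<in>rel_syms L. rel_int M R = rel_int N R \<inter> (rel_ar L R \<rightarrow>\<^sub>E univ M))"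

definition embedding ::
  "('f, 'r, 'i) language \<Rightarrow> ('u \<Rightarrow> 'u) \<Rightarrow> ('u, 'f, 'r, 'i) model \<Rightarrow> ('u, 'f, 'r, 'i) model \<Rightarrow> bool"
where
  "embedding L f M N \<longleftrightarrow> inj_on f (univ M) \<and> f ` univ M \<subseteq> univ N \<and>
     (\<forall>F\<in>fun_syms L. \<forall>xs \<in> fun_ar L F \<rightarrow>\<^sub>E univ M.
        f (fun_int M F xs) = fun_int N F (compose (fun_ar L F) f xs)) \<and>
     (\<forall>R\<in>rel_syms L. \<forall>xs \<in> rel_ar L R \<rightarrow>\<^sub>E univ M.
        xs \<in> rel_int M R \<longleftrightarrow> compose (rel_ar L R) f xs \<in> rel_int N R)"

definition isomorphism ::
  "('f, 'r, 'i) language \<Rightarrow> ('u \<Rightarrow> 'u) \<Rightarrow> ('u, 'f, 'r, 'i) model \<Rightarrow> ('u, 'f, 'r, 'i) model \<Rightarrow> bool"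
where
  "isomorphism L f M N \<longleftrightarrow> embedding L f M N \<and> f ` univ M = univ N"

(* The structure f(M), for f injective on M. *)
definition image_struct ::
  "('f, 'r, 'i) language \<Rightarrow> ('u \<Rightarrow> 'u) \<Rightarrow> ('u, 'f, 'r, 'i) model \<Rightarrow> ('u, 'f, 'r, 'i) model"
where
  "image_struct L f M =
    \<lparr> univ = f ` univ M,
      fun_int = (\<lambda>F \<in> fun_syms L. \<lambda>ys \<in> fun_ar L F \<rightarrow>\<^sub>E f ` univ M.
        f (fun_int M F (compose (fun_ar L F) (inv_into (univ M) f) ys))),
      rel_int = (\<lambda>R \<in> rel_syms L. compose (rel_ar L R) f ` rel_int M R) \<rparr>"

(* A function symbol takes at xs the value it has in any member of the family containing xs;
   in a directed system that value is unique. *)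
definition union_struct ::
  "('f, 'r, 'i) language \<Rightarrow> 'u set \<Rightarrow> ('u \<Rightarrow> ('u, 'f, 'r, 'i) model) \<Rightarrow> ('u, 'f, 'r, 'i) model"
where
  "union_struct L I M =
    \<lparr> univ = (\<Union>i\<in>I. univ (M i)),
      fun_int = (\<lambda>F \<in> fun_syms L. \<lambda>xs \<in> fun_ar L F \<rightarrow>\<^sub>E (\<Union>i\<in>I. univ (M i)).
        THE y. \<exists>i\<in>I. xs \<in> (fun_ar L F \<rightarrow>\<^sub>E univ (M i)) \<and> y = fun_int (M i) F xs),
      rel_int = (\<lambda>R \<in> rel_syms L. \<Union>i\<in>I. rel_int (M i) R) \<rparr>"


section \<open>Abstract classes and \<open>\<mu>\<close>-AECs\<close>

locale abstract_class =
  fixes L :: "('f, 'r, 'i) language"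
    and K :: "('u, 'f, 'r, 'i) model set"
    and le :: "('u, 'f, 'r, 'i) model \<Rightarrow> ('u, 'f, 'r, 'i) model \<Rightarrow> bool"
  assumes nonempty: "K \<noteq> {}"
    and structs: "M \<in> K \<Longrightarrow> is_struct L M"
    and le_in_K: "le M N \<Longrightarrow> M \<in> K \<and> N \<in> K"
    and le_refl: "M \<in> K \<Longrightarrow> le M M"
    and le_trans: "le M N \<Longrightarrow> le N P \<Longrightarrow> le M P"
    and le_substruct: "le M N \<Longrightarrow> substruct L M N"
    and iso_closed: "N \<in> K \<Longrightarrow> is_struct L N' \<Longrightarrow> isomorphism L f N N' \<Longrightarrow> N' \<in> K"
    and iso_closed_le: "le M N \<Longrightarrow> is_struct L N' \<Longrightarrow> isomorphism L f N N' \<Longrightarrow>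
      image_struct L f M \<in> K \<and> le (image_struct L f M) N'"

definition K_embedding ::
  "('f, 'r, 'i) language \<Rightarrow> ('u, 'f, 'r, 'i) model set \<Rightarrow>
   (('u, 'f, 'r, 'i) model \<Rightarrow> ('u, 'f, 'r, 'i) model \<Rightarrow> bool) \<Rightarrow>
   ('u \<Rightarrow> 'u) \<Rightarrow> ('u, 'f, 'r, 'i) model \<Rightarrow> ('u, 'f, 'r, 'i) model \<Rightarrow> bool"
where
  "K_embedding L K le f M N \<longleftrightarrow>
     M \<in> K \<and> N \<in> K \<and> embedding L f M N \<and> le (image_struct L f M) N"

definition directed_poset :: "'m rel \<Rightarrow> 'u set \<Rightarrow> 'u rel \<Rightarrow> bool" where
  "directed_poset mu I r \<longleftrightarrow> partial_order_on I r \<and>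
     (\<forall>X\<subseteq>I. |X| <o mu \<longrightarrow> (\<exists>b\<in>I. \<forall>x\<in>X. (x, b) \<in> r))"

(* Index sets are small; every small poset is isomorphic to one whose points are in 'u. *)
definition directed_system ::
  "('u, 'f, 'r, 'i) model set \<Rightarrow>
   (('u, 'f, 'r, 'i) model \<Rightarrow> ('u, 'f, 'r, 'i) model \<Rightarrow> bool) \<Rightarrow> 'm rel \<Rightarrow>
   'u set \<Rightarrow> 'u rel \<Rightarrow> ('u \<Rightarrow> ('u, 'f, 'r, 'i) model) \<Rightarrow> bool"
where
  "directed_system K le mu I r M \<longleftrightarrow> small I \<and> directed_poset mu I r \<and> (\<forall>i\<in>I. M i \<in> K) \<and>
     (\<forall>i j. (i, j) \<in> r \<and> i \<noteq> j \<longrightarrow> le (M i) (M j))"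

definition LS_property ::
  "('f, 'r, 'i) language \<Rightarrow> ('u, 'f, 'r, 'i) model set \<Rightarrow>
   (('u, 'f, 'r, 'i) model \<Rightarrow> ('u, 'f, 'r, 'i) model \<Rightarrow> bool) \<Rightarrow> 'm rel \<Rightarrow> 'u rel \<Rightarrow> bool"
where
  "LS_property L K le mu theta \<longleftrightarrow>
     Card_order theta \<and> theta <o |UNIV :: 'u set| \<and>
     theta =o cexp_less theta mu \<and>
     |fun_syms L <+> rel_syms L| +c mu \<le>o theta \<and>
     (\<forall>M\<in>K. \<forall>A\<subseteq>univ M. \<exists>M0\<in>K. A \<subseteq> univ M0 \<and> le M0 M \<and>
        |univ M0| \<le>o cexp_less |A| mu +c theta)"

locale mu_AEC = abstract_class L K le
  for L :: "('f, 'r, 'i) language"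
    and K :: "('u, 'f, 'r, 'i) model set"
    and le :: "('u, 'f, 'r, 'i) model \<Rightarrow> ('u, 'f, 'r, 'i) model \<Rightarrow> bool" +
  fixes mu :: "'m rel"
  assumes coherence: "M0 \<in> K \<Longrightarrow> M1 \<in> K \<Longrightarrow> M2 \<in> K \<Longrightarrow>
      le M0 M2 \<Longrightarrow> substruct L M0 M1 \<Longrightarrow> le M1 M2 \<Longrightarrow> le M0 M1"
    and continuity: "directed_system K le mu I r M \<Longrightarrow>
      union_struct L I M \<in> K \<and> (\<forall>i\<in>I. le (M i) (union_struct L I M))"
    and smoothness: "N \<in> K \<Longrightarrow> directed_system K le mu I r M \<Longrightarrow> (\<forall>i\<in>I. le (M i) N) \<Longrightarrow>
      union_struct L I M \<in> K \<Longrightarrow> le (union_struct L I M) N"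
    and loewenheim_skolem: "\<exists>theta. LS_property L K le mu theta"

definition LS_number ::
  "('f, 'r, 'i) language \<Rightarrow> ('u, 'f, 'r, 'i) model set \<Rightarrow>
   (('u, 'f, 'r, 'i) model \<Rightarrow> ('u, 'f, 'r, 'i) model \<Rightarrow> bool) \<Rightarrow> 'm rel \<Rightarrow> 'u rel"
where
  "LS_number L K le mu = (SOME theta. LS_property L K le mu theta \<and>
     (\<forall>theta'. LS_property L K le mu theta' \<longrightarrow> theta \<le>o theta'))"


section \<open>Orbital types, stability, amalgamation\<close>

definition E_at ::
  "('f, 'r, 'i) language \<Rightarrow> ('u, 'f, 'r, 'i) model set \<Rightarrow>
   (('u, 'f, 'r, 'i) model \<Rightarrow> ('u, 'f, 'r, 'i) model \<Rightarrow> bool) \<Rightarrow>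
   ('u \<times> 'u set \<times> ('u, 'f, 'r, 'i) model) rel"
where
  "E_at L K le = {((b1, A, N1), (b2, A, N2)) |b1 b2 A N1 N2.
     N1 \<in> K \<and> N2 \<in> K \<and> A \<subseteq> univ N1 \<and> A \<subseteq> univ N2 \<and> b1 \<in> univ N1 \<and> b2 \<in> univ N2 \<and>
     (\<exists>N f1 f2. K_embedding L K le f1 N1 N \<and> K_embedding L K le f2 N2 N \<and>
        f1 b1 = f2 b2 \<and> (\<forall>a\<in>A. f1 a = a \<and> f2 a = a))}"

definition ortp ::
  "('f, 'r, 'i) language \<Rightarrow> ('u, 'f, 'r, 'i) model set \<Rightarrow>
   (('u, 'f, 'r, 'i) model \<Rightarrow> ('u, 'f, 'r, 'i) model \<Rightarrow> bool) \<Rightarrow>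
   'u \<Rightarrow> 'u set \<Rightarrow> ('u, 'f, 'r, 'i) model \<Rightarrow> ('u \<times> 'u set \<times> ('u, 'f, 'r, 'i) model) set"
where
  "ortp L K le b A N = (E_at L K le)\<^sup>+ `` {(b, A, N)}"

definition types_in ::
  "('f, 'r, 'i) language \<Rightarrow> ('u, 'f, 'r, 'i) model set \<Rightarrow>
   (('u, 'f, 'r, 'i) model \<Rightarrow> ('u, 'f, 'r, 'i) model \<Rightarrow> bool) \<Rightarrow>
   ('u, 'f, 'r, 'i) model \<Rightarrow> ('u, 'f, 'r, 'i) model \<Rightarrow>
   ('u \<times> 'u set \<times> ('u, 'f, 'r, 'i) model) set set"
where
  "types_in L K le M N = {ortp L K le c (univ M) N |c. c \<in> univ N}"

definition types_over ::
  "('f, 'r, 'i) language \<Rightarrow> ('u, 'f, 'r, 'i) model set \<Rightarrow>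
   (('u, 'f, 'r, 'i) model \<Rightarrow> ('u, 'f, 'r, 'i) model \<Rightarrow> bool) \<Rightarrow>
   ('u, 'f, 'r, 'i) model \<Rightarrow> ('u \<times> 'u set \<times> ('u, 'f, 'r, 'i) model) set set"
where
  "types_over L K le M = (\<Union>N \<in> {N \<in> K. le M N}. types_in L K le M N)"

definition lambda_stable ::
  "('f, 'r, 'i) language \<Rightarrow> ('u, 'f, 'r, 'i) model set \<Rightarrow>
   (('u, 'f, 'r, 'i) model \<Rightarrow> ('u, 'f, 'r, 'i) model \<Rightarrow> bool) \<Rightarrow> 'l rel \<Rightarrow> bool"
where
  "lambda_stable L K le lam \<longleftrightarrow>
     (\<forall>M\<in>K. |univ M| =o lam \<longrightarrow> |types_over L K le M| \<le>o lam)"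

definition almost_lambda_stable ::
  "('f, 'r, 'i) language \<Rightarrow> ('u, 'f, 'r, 'i) model set \<Rightarrow>
   (('u, 'f, 'r, 'i) model \<Rightarrow> ('u, 'f, 'r, 'i) model \<Rightarrow> bool) \<Rightarrow> 'l rel \<Rightarrow> bool"
where
  "almost_lambda_stable L K le lam \<longleftrightarrow>
     (\<forall>M\<in>K. \<forall>N\<in>K. le M N \<and> |univ M| =o lam \<longrightarrow> |types_in L K le M N| \<le>o lam)"

definition infinity_AP ::
  "('f, 'r, 'i) language \<Rightarrow> ('u, 'f, 'r, 'i) model set \<Rightarrow>
   (('u, 'f, 'r, 'i) model \<Rightarrow> ('u, 'f, 'r, 'i) model \<Rightarrow> bool) \<Rightarrow> bool"
where
  "infinity_AP L K le \<longleftrightarrow>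
     (\<forall>(I :: 'u set) M Mi f. small I \<and> M \<in> K \<and> (\<forall>i\<in>I. K_embedding L K le (f i) M (Mi i)) \<longrightarrow>
        (\<exists>N\<in>K. \<exists>g. (\<forall>i\<in>I. K_embedding L K le (g i) (Mi i) N) \<and>
           (\<forall>i\<in>I. \<forall>j\<in>I. \<forall>x\<in>univ M. g i (f i x) = g j (f j x))))"

end

theory Submission
  imports Defs
begin

text \<open>
  Given \<open>M \<preceq>\<^sub>1 N\<close> with \<open>|M| = \<lambda>\<close>, the Loewenheim-Skolem axiom of \<open>K\<^sub>2\<close> provides \<open>M\<^sub>0 \<preceq>\<^sub>2 N\<close> of
  cardinality \<open>\<lambda>\<close> containing \<open>M\<close>. Every \<open>K\<^sub>2\<close>-embedding is a \<open>K\<^sub>1\<close>-embedding, so elements of \<open>N\<close>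
  with the same \<open>K\<^sub>2\<close>-type over \<open>M\<^sub>0\<close> have the same \<open>K\<^sub>1\<close>-type over the smaller set \<open>M\<close>; hence
  \<open>|S\<^sub>1(M;N)| \<le> |S\<^sub>2(M\<^sub>0;N)| \<le> \<lambda>\<close>. If \<open>S\<^sub>1(M)\<close> had more than \<open>\<lambda>\<close> elements, then \<open>\<infinity>\<close>-AP would
  realize \<open>\<lambda>\<^sup>+\<close> of them in a single extension of \<open>M\<close>, contradicting almost \<open>\<lambda>\<close>-stability.
\<close>

section \<open>Cardinals\<close>

lemma not_ordLeq_iff_ordLess_Card_order:
  "Card_order r \<Longrightarrow> Card_order r' \<Longrightarrow> \<not> r' \<le>o r \<longleftrightarrow> r <o r'"
  by (rule not_ordLeq_iff_ordLess) (auto simp: card_order_on_def)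

text \<open>\<open>G\<close> factors through \<open>F\<close> on \<open>X\<close>: choosing a
  preimage of a value of \<open>F\<close> and applying \<open>G\<close> covers every value of
  \<open>G\<close>. Later \<open>F\<close> and \<open>G\<close> send an element to its types in the
  two classes.\<close>

lemma card_of_image_factor:
  assumes "\<And>c d. c \<in> X \<Longrightarrow> d \<in> X \<Longrightarrow> F c = F d \<Longrightarrow> G c = G d"
  shows "|G ` X| \<le>o |F ` X|"
proof -
  have "G c = G (inv_into X F (F c))" if "c \<in> X" for c
    using assms[of c "inv_into X F (F c)"] that by (simp add: inv_into_into f_inv_into_f)
  then have "G ` X \<subseteq> (\<lambda>t. G (inv_into X F t)) ` F ` X"
    by auto
  then show ?thesis
    by (meson card_of_image card_of_mono1 ordLeq_transitive)
qed

text \<open>Each power \<open>k ^c eta\<close> lies below \<open>k' ^c eta\<close>, hence below the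
  supremum for \<open>k'\<close>. The two cardinals may live on different types, as
  \<open>|univ M|\<close> and \<open>lam\<close> do in the application.\<close>

lemma cexp_less_mono:
  fixes k :: "'a rel" and k' :: "'b rel" and mu :: "'m rel"
  assumes "Card_order k" "k \<le>o k'"
  shows "cexp_less k mu \<le>o cexp_less k' mu"
proof -
  let ?S = "{k ^c eta |eta :: 'm rel. Card_order eta \<and> eta <o mu}"
  let ?s' = "cexp_less k' mu"
  have least: "cexp_less k mu \<le>o c" if "Card_order c" "\<forall>r\<in>?S. r \<le>o c" for c :: "('m \<Rightarrow> 'a) rel"
    using cexp_less_is_card_sup[of k mu] that unfolding is_card_sup_def by blast
  have ub: "k' ^c eta \<le>o ?s'" if "Card_order eta" "eta <o mu" for eta :: "'m rel"
    using cexp_less_is_card_sup[of k' mu] that unfolding is_card_sup_def by blast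
  have s': "Card_order ?s'"
    using cexp_less_is_card_sup[of k' mu] unfolding is_card_sup_def by auto
  have le: "r \<le>o ?s'" if "r \<in> ?S" for r
    using that cexp_mono1[OF assms(2)] ub ordLeq_transitive by blast
  have univ: "r \<le>o |UNIV :: ('m \<Rightarrow> 'a) set|" if "Card_order r" for r :: "('m \<Rightarrow> 'a) rel"
    using card_of_Field_ordIso[OF that] card_of_mono1[of "Field r" UNIV]
    by (metis ordIso_ordLeq_trans ordIso_symmetric subset_UNIV)
  \<comment> \<open>The supremum \<open>cexp_less k mu\<close> is least only among cardinals on its own type, so the bound \<open>?s'\<close>
    has to be copied to that type; if it does not fit there, the claim is trivial.\<close>
  show ?thesis
  proof (cases "?s' \<le>o |UNIV :: ('m \<Rightarrow> 'a) set|")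
    case True
    have "|Field ?s'| \<le>o |UNIV :: ('m \<Rightarrow> 'a) set|"
      using card_of_Field_ordIso[OF s'] True ordIso_ordLeq_trans by blast
    then obtain f :: "_ \<Rightarrow> 'm \<Rightarrow> 'a" where f: "inj_on f (Field ?s')"
      using card_of_ordLeq[of "Field ?s'" "UNIV :: ('m \<Rightarrow> 'a) set"] by auto
    have eq: "?s' =o |f ` Field ?s'|"
      using card_of_Field_ordIso[OF s'] f
      by (meson bij_betw_imageI card_of_ordIso ordIso_symmetric ordIso_transitive)
    have "cexp_less k mu \<le>o |f ` Field ?s'|"
      by (rule least) (use le eq ordLeq_ordIso_trans in \<open>auto simp: card_of_Card_order\<close>)
    then show ?thesis
      using eq ordIso_symmetric ordLeq_ordIso_trans by blast
  next
    case False
    then have "|UNIV :: ('m \<Rightarrow> 'a) set| \<le>o ?s'"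
      using not_ordLeq_iff_ordLess_Card_order[OF card_of_Card_order s'] ordLess_imp_ordLeq by blast
    moreover have "Card_order (cexp_less k mu)"
      using cexp_less_is_card_sup[of k mu] unfolding is_card_sup_def by auto
    ultimately show ?thesis
      using univ ordLeq_transitive by blast
  qed
qed

lemma small_if_card_of_ordLeq:
  fixes A B :: "'u set"
  shows "|A| \<le>o |B| \<Longrightarrow> small B \<Longrightarrow> small A"
  unfolding small_def by (rule ordLeq_ordLess_trans)

text \<open>There is room for the points of \<open>A - B\<close>: the complement of a small set in
  an infinite universe has the size of the whole universe.\<close>

lemma extend_inj_on_small:
  fixes A :: "'u set"
  assumes inf: "infinite (UNIV :: 'u set)" and A: "small A" "B \<subseteq> A"
    and h: "inj_on h B"
  obtains s :: "'u \<Rightarrow> 'u" where "inj_on s A" "\<And>x. x \<in> B \<Longrightarrow> s x = h x"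
proof -
  have "small (h ` B)"
    using A card_of_image card_of_mono1 ordLeq_transitive small_if_card_of_ordLeq by metis
  \<comment> \<open>Otherwise the universe would be a union of two sets smaller than itself.\<close>
  then have "\<not> |- h ` B| <o |UNIV :: 'u set|"
    using card_of_Un_ordLess_infinite[OF inf, of "h ` B" "- h ` B"] ordLess_irreflexive
    unfolding small_def by auto
  then have "|UNIV :: 'u set| \<le>o |- h ` B|"
    using not_ordLeq_iff_ordLess_Card_order[OF card_of_Card_order card_of_Card_order] by blast
  moreover have "|A - B| \<le>o |UNIV :: 'u set|"
    by (rule card_of_mono1) simp
  ultimately have "|A - B| \<le>o |- h ` B|"
    using ordLeq_transitive by blast
  then obtain t where t: "inj_on t (A - B)" "t ` (A - B) \<subseteq> - h ` B"
    unfolding card_of_ordLeq[symmetric] by blast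
  show thesis
  proof
    have "inj_on (\<lambda>x. if x \<in> B then h x else t x) (B \<union> (A - B))"
    proof (rule inj_on_disjoint_Un)
      show "h ` B \<inter> t ` (A - B) = {}"
        using t(2) by blast
    qed (use h t in auto)
    then show "inj_on (\<lambda>x. if x \<in> B then h x else t x) A"
      using A(2) by (simp add: Un_absorb1)
  qed auto
qed

section \<open>Renaming the points of a structure\<close>

lemma compose_PiE: "xs \<in> A \<rightarrow>\<^sub>E B \<Longrightarrow> f ` B \<subseteq> C \<Longrightarrow> compose A f xs \<in> A \<rightarrow>\<^sub>E C"
  by (auto simp: compose_def PiE_iff)

lemma compose_inverse:
  "xs \<in> A \<rightarrow>\<^sub>E B \<Longrightarrow> (\<And>x. x \<in> B \<Longrightarrow> g (f x) = x) \<Longrightarrow> compose A g (compose A f xs) = xs"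
  by (rule extensionalityI[of _ A]) (auto simp: compose_def PiE_iff)

lemma inj_on_compose: "inj_on f B \<Longrightarrow> inj_on (compose A f) (A \<rightarrow>\<^sub>E B)"
  by (rule inj_on_inverseI[where g = "compose A (inv_into B f)"]) (simp add: compose_inverse)

lemma compose_compose: "compose A f (compose A g xs) = compose A (f \<circ> g) xs"
  by (auto simp: compose_def)

lemma univ_image_struct [simp]: "univ (image_struct L f M) = f ` univ M"
  by (simp add: image_struct_def)

lemma is_structD:
  assumes "is_struct L M"
  shows "small (univ M)"
    and "F \<in> fun_syms L \<Longrightarrow> xs \<in> fun_ar L F \<rightarrow>\<^sub>E univ M \<Longrightarrow> fun_int M F xs \<in> univ M"
    and "R \<in> rel_syms L \<Longrightarrow> rel_int M R \<subseteq> rel_ar L R \<rightarrow>\<^sub>E univ M"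
    and "fun_int M \<in> extensional (fun_syms L)"
    and "F \<in> fun_syms L \<Longrightarrow> fun_int M F \<in> extensional (fun_ar L F \<rightarrow>\<^sub>E univ M)"
    and "rel_int M \<in> extensional (rel_syms L)"
  using assms unfolding is_struct_def by (auto simp: PiE_def Pi_def)

lemma is_struct_image_struct:
  assumes M: "is_struct L M"
  shows "is_struct L (image_struct L f M)"
proof -
  have 1: "small (f ` univ M)"
    using is_structD(1)[OF M] card_of_image small_if_card_of_ordLeq by metis
  have 2: "fun_int M F (compose (fun_ar L F) (inv_into (univ M) f) ys) \<in> univ M"
    if "F \<in> fun_syms L" "ys \<in> fun_ar L F \<rightarrow>\<^sub>E f ` univ M" for F ys
    by (rule is_structD(2)[OF M that(1)], rule compose_PiE[OF that(2)])
      (auto intro: inv_into_into)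
  have 3: "compose (rel_ar L R) f xs \<in> rel_ar L R \<rightarrow>\<^sub>E f ` univ M"
    if "R \<in> rel_syms L" "xs \<in> rel_int M R" for R xs
    using is_structD(3)[OF M that(1)] that(2) by (intro compose_PiE[of _ _ "univ M"]) auto
  show ?thesis
    unfolding is_struct_def image_struct_def
    by (simp only: model.simps restrict_PiE_iff) (use 1 2 3 in blast)
qed

lemma isomorphism_image_struct:
  fixes L :: "('f, 'r, 'i) language"
  assumes M: "is_struct L M" and f: "inj_on f (univ M)"
  shows "isomorphism L f M (image_struct L f M)"
proof -
  have 1: "compose A f xs \<in> A \<rightarrow>\<^sub>E f ` univ M" if "xs \<in> A \<rightarrow>\<^sub>E univ M" for A :: "'i set" and xs
    by (rule compose_PiE[OF that]) auto
  have 2: "compose A (inv_into (univ M) f) (compose A f xs) = xs" if "xs \<in> A \<rightarrow>\<^sub>E univ M"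
    for A :: "'i set" and xs
    by (rule compose_inverse[OF that]) (simp add: f)
  \<comment> \<open>Injectivity of \<open>f\<close> passes to tuples, so no tuple outside
    \<open>rel_int M R\<close> acquires an image inside the image relation.\<close>
  have 3: "xs \<in> rel_int M R \<longleftrightarrow> compose (rel_ar L R) f xs \<in> compose (rel_ar L R) f ` rel_int M R"
    if "R \<in> rel_syms L" "xs \<in> rel_ar L R \<rightarrow>\<^sub>E univ M" for R xs
    using inj_on_image_mem_iff[OF inj_on_compose[OF f] that(2) is_structD(3)[OF M that(1)]]
    by simp
  show ?thesis
    unfolding isomorphism_def embedding_def
    using f 3 by (simp add: image_struct_def 1 2)
qed

text \<open>On the range of \<open>s \<circ> g\<close> the inverse of the composite is the composite
  of the inverses. Literal equality allows \<open>iso_closed_le\<close>, which yields an image of an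
  image, to be read as a statement about \<open>s \<circ> g\<close>.\<close>

lemma image_struct_image_struct:
  fixes L :: "('f, 'r, 'i) language"
  assumes M: "is_struct L M" and g: "inj_on g (univ M)" and s: "inj_on s (g ` univ M)"
  shows "image_struct L s (image_struct L g M) = image_struct L (s \<circ> g) M"
proof -
  have sg: "inj_on (s \<circ> g) (univ M)"
    using g s by (rule comp_inj_on)
  have inv: "compose A (inv_into (univ M) g) (compose A (inv_into (g ` univ M) s) ys) =
      compose A (inv_into (univ M) (s \<circ> g)) ys" if ys: "ys \<in> A \<rightarrow>\<^sub>E s ` g ` univ M"
    for A :: "'i set" and ys
  proof (rule extensionalityI)
    fix a assume a: "a \<in> A"
    then obtain x where x: "x \<in> univ M" "ys a = s (g x)"
      using PiE_mem[OF ys] by blast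
    then show "compose A (inv_into (univ M) g) (compose A (inv_into (g ` univ M) s) ys) a =
        compose A (inv_into (univ M) (s \<circ> g)) ys a"
      using a g s inv_into_f_f[OF sg x(1)] by (simp add: compose_eq)
  qed auto
  have P: "compose A (inv_into (g ` univ M) s) ys \<in> A \<rightarrow>\<^sub>E g ` univ M"
    if "ys \<in> A \<rightarrow>\<^sub>E s ` g ` univ M" for A :: "'i set" and ys
    by (rule compose_PiE[OF that]) (auto intro: inv_into_into)
  show ?thesis
    unfolding image_struct_def
    by (simp add: image_comp[symmetric] inv P cong: restrict_cong)
      (simp add: image_image compose_compose)
qed

text \<open>Equality is literal because the interpretations of a structure are extensional; the
  values of \<open>f\<close> outside \<open>univ M\<close> are arbitrary.\<close>

lemma image_struct_ident:
  fixes L :: "('f, 'r, 'i) language"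
  assumes M: "is_struct L M" and f: "\<And>x. x \<in> univ M \<Longrightarrow> f x = x"
  shows "image_struct L f M = M"
proof (rule model.equality)
  have img: "f ` univ M = univ M"
    using f by simp
  have inj: "inj_on f (univ M)"
    using f by (simp add: inj_on_def)
  have inv: "inv_into (univ M) f x = x" if "x \<in> univ M" for x
    using inv_into_f_f[OF inj that] f[OF that] by simp
  have cmp: "compose A g xs = xs" if "xs \<in> A \<rightarrow>\<^sub>E univ M" "\<And>x. x \<in> univ M \<Longrightarrow> g x = x"
    for A :: "'i set" and g xs
    using that by (intro extensionalityI[of _ A]) (auto simp: compose_def PiE_iff)
  show "univ (image_struct L f M) = univ M"
    by (simp add: img)
  show "fun_int (image_struct L f M) = fun_int M"
  proof (rule extensionalityI[OF _ is_structD(4)[OF M]])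
    fix F assume F: "F \<in> fun_syms L"
    have "fun_int (image_struct L f M) F =
        (\<lambda>ys \<in> fun_ar L F \<rightarrow>\<^sub>E univ M.
          f (fun_int M F (compose (fun_ar L F) (inv_into (univ M) f) ys)))"
      using F by (simp add: image_struct_def img)
    also have "\<dots> = (\<lambda>ys \<in> fun_ar L F \<rightarrow>\<^sub>E univ M. fun_int M F ys)"
      by (rule restrict_ext) (simp add: cmp[OF _ inv] f is_structD(2)[OF M F])
    also have "\<dots> = fun_int M F"
      by (rule extensional_restrict[OF is_structD(5)[OF M F]])
    finally show "fun_int (image_struct L f M) F = fun_int M F" .
  qed (simp add: image_struct_def)
  show "rel_int (image_struct L f M) = rel_int M"
  proof (rule extensionalityI[OF _ is_structD(6)[OF M]])
    fix R assume R: "R \<in> rel_syms L"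
    have "compose (rel_ar L R) f xs = xs" if "xs \<in> rel_int M R" for xs
      using is_structD(3)[OF M R] that f by (intro cmp) auto
    then show "rel_int (image_struct L f M) R = rel_int M R"
      using R by (simp add: image_struct_def)
  qed (simp add: image_struct_def)
qed simp

lemma embedding_comp:
  fixes L :: "('f, 'r, 'i) language"
  assumes g: "embedding L g M N" and s: "embedding L s N P"
  shows "embedding L (s \<circ> g) M P"
proof -
  have img: "g ` univ M \<subseteq> univ N" and "inj_on g (univ M)" "inj_on s (univ N)"
    using g s by (auto simp: embedding_def)
  then have inj: "inj_on (s \<circ> g) (univ M)"
    by (blast intro: comp_inj_on inj_on_subset)
  have P: "compose A g xs \<in> A \<rightarrow>\<^sub>E univ N" if "xs \<in> A \<rightarrow>\<^sub>E univ M" for A :: "'i set" and xs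
    using compose_PiE[OF that img] .
  have "(s \<circ> g) (fun_int M F xs) = fun_int P F (compose (fun_ar L F) (s \<circ> g) xs)"
    if "F \<in> fun_syms L" "xs \<in> fun_ar L F \<rightarrow>\<^sub>E univ M" for F xs
    using g s that P[OF that(2)] unfolding embedding_def
    by (simp add: compose_compose[of _ s g, symmetric])
  moreover have "xs \<in> rel_int M R \<longleftrightarrow> compose (rel_ar L R) (s \<circ> g) xs \<in> rel_int P R"
    if "R \<in> rel_syms L" "xs \<in> rel_ar L R \<rightarrow>\<^sub>E univ M" for R xs
    using g s that P[OF that(2)] unfolding embedding_def
    by (simp add: compose_compose[of _ s g, symmetric])
  moreover have "(s \<circ> g) ` univ M \<subseteq> univ P"
    using g s unfolding embedding_def by auto
  ultimately show ?thesis
    using inj unfolding embedding_def by blast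
qed

lemma E_atI:
  assumes "K_embedding L K le f1 N1 N" "K_embedding L K le f2 N2 N"
    and "A \<subseteq> univ N1" "A \<subseteq> univ N2" "b1 \<in> univ N1" "b2 \<in> univ N2"
    and "f1 b1 = f2 b2" "\<And>a. a \<in> A \<Longrightarrow> f1 a = a" "\<And>a. a \<in> A \<Longrightarrow> f2 a = a"
  shows "((b1, A, N1), (b2, A, N2)) \<in> E_at L K le"
proof -
  have "N1 \<in> K" "N2 \<in> K" "\<forall>a\<in>A. f1 a = a \<and> f2 a = a"
    using assms by (auto simp: K_embedding_def)
  then show ?thesis
    unfolding E_at_def mem_Collect_eq using assms(1-7)
    by - (intro exI conjI, rule refl, assumption+)
qed

lemma E_atE:
  assumes "((b1, A, N1), (b2, B, N2)) \<in> E_at L K le"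
  obtains N f1 f2 where "B = A" "K_embedding L K le f1 N1 N" "K_embedding L K le f2 N2 N"
    "A \<subseteq> univ N1" "A \<subseteq> univ N2" "b1 \<in> univ N1" "b2 \<in> univ N2"
    "f1 b1 = f2 b2" "\<And>a. a \<in> A \<Longrightarrow> f1 a = a" "\<And>a. a \<in> A \<Longrightarrow> f2 a = a"
  using assms unfolding E_at_def by simp metis

section \<open>Embeddings within an abstract class\<close>

context abstract_class
begin

lemma K_embedding_ident:
  assumes "le M N" "\<And>x. x \<in> univ M \<Longrightarrow> f x = x"
  shows "K_embedding L K le f M N"
proof -
  have K: "M \<in> K" "N \<in> K" and sub: "substruct L M N" and M: "is_struct L M"
    using assms(1) le_in_K le_substruct structs by blast+
  have cmp: "compose A f xs = xs" if "xs \<in> A \<rightarrow>\<^sub>E univ M" for A :: "'i set" and xs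
    using that assms(2) by (intro extensionalityI[of _ A]) (auto simp: compose_def PiE_iff)
  have "embedding L f M N"
    using sub is_structD(2)[OF M] assms(2) unfolding substruct_def embedding_def
    by (auto simp: cmp inj_on_def)
  then show ?thesis
    using K assms image_struct_ident[OF M assms(2)] by (simp add: K_embedding_def)
qed

text \<open>Invariance under isomorphism, applied to \<open>s\<close> on \<open>N\<close>, carries
  the relation between the image of \<open>g\<close> and \<open>N\<close> over to the renamed
  structures.\<close>

lemma K_embedding_isomorphism:
  assumes g: "K_embedding L K le g M N" and s: "inj_on s (univ N)"
  shows "K_embedding L K le (s \<circ> g) M (image_struct L s N)"
proof -
  have K: "M \<in> K" "N \<in> K" and emb: "embedding L g M N" and le: "le (image_struct L g M) N"
    using g by (auto simp: K_embedding_def)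
  have N': "is_struct L (image_struct L s N)" and iso: "isomorphism L s N (image_struct L s N)"
    using K s structs is_struct_image_struct isomorphism_image_struct by blast+
  have inj: "inj_on g (univ M)" "inj_on s (g ` univ M)"
    using emb inj_on_subset[OF s] by (simp_all add: embedding_def)
  have "le (image_struct L s (image_struct L g M)) (image_struct L s N)"
    using iso_closed_le[OF le N' iso] by simp
  then have "le (image_struct L (s \<circ> g) M) (image_struct L s N)"
    using image_struct_image_struct[OF structs inj] K by simp
  moreover have "embedding L (s \<circ> g) M (image_struct L s N)"
    using embedding_comp[OF emb] iso unfolding isomorphism_def by blast
  ultimately show ?thesis
    using K iso_closed[OF _ N' iso] by (simp add: K_embedding_def)
qed

section \<open>Orbital types\<close>

lemma sym_E_at: "sym (E_at L K le)"
proof (rule symI)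
  fix p q assume "(p, q) \<in> E_at L K le"
  then show "(q, p) \<in> E_at L K le"
    by (cases p; cases q) (auto elim!: E_atE intro: E_atI)
qed

text \<open>The model itself with identity maps is a witness. This puts a genuine triple into its
  own class, which \<open>ortp\<close>, an image under a merely transitive closure, does not give by
  definition.\<close>

lemma E_at_refl:
  assumes "N \<in> K" "A \<subseteq> univ N" "b \<in> univ N"
  shows "((b, A, N), (b, A, N)) \<in> E_at L K le"
proof -
  have id: "K_embedding L K le id N N"
    using K_embedding_ident[OF le_refl[OF assms(1)]] by simp
  show ?thesis
    by (rule E_atI[OF id id]) (use assms in simp_all)
qed

lemma ortp_eqI:
  assumes "(p, q) \<in> (E_at L K le)\<^sup>+" "p = (b, A, N)" "q = (c, B, P)"
  shows "ortp L K le b A N = ortp L K le c B P"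
proof -
  have "(q, p) \<in> (E_at L K le)\<^sup>+"
    using assms(1) sym_E_at sym_trancl symD by metis
  then show ?thesis
    using assms unfolding ortp_def by (auto intro: trancl_trans)
qed

lemma ortp_eqD:
  assumes "ortp L K le b A N = ortp L K le c A N" "N \<in> K" "A \<subseteq> univ N" "c \<in> univ N"
  shows "((b, A, N), (c, A, N)) \<in> (E_at L K le)\<^sup>+"
  using assms(1) E_at_refl[OF assms(2-4)] unfolding ortp_def by auto

text \<open>A single step suffices: \<open>P\<close> is the common extension, with \<open>g\<close>
  on one side and the identity on the other.\<close>

lemma ortp_K_embedding:
  assumes g: "K_embedding L K le g N P" and A: "A \<subseteq> univ N" "\<And>a. a \<in> A \<Longrightarrow> g a = a"
    and b: "b \<in> univ N"
  shows "ortp L K le b A N = ortp L K le (g b) A P"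
proof -
  have K: "N \<in> K" "P \<in> K" and P: "g ` univ N \<subseteq> univ P"
    using g by (auto simp: K_embedding_def embedding_def)
  have "A \<subseteq> univ P"
  proof
    fix a assume "a \<in> A"
    then have "a \<in> univ N" "g a = a"
      using A by auto
    then show "a \<in> univ P"
      using P imageI[of a "univ N" g] by auto
  qed
  have id: "K_embedding L K le id P P"
    using K_embedding_ident[OF le_refl[OF K(2)]] by simp
  have "g b \<in> univ P"
    using P b by blast
  then have "((b, A, N), (g b, A, P)) \<in> E_at L K le"
    by (intro E_atI[OF g id]) (use A b \<open>A \<subseteq> univ P\<close> in simp_all)
  then show ?thesis
    by (intro ortp_eqI[OF r_into_trancl]) auto
qed

text \<open>
  The common restriction of the amalgamating maps to \<open>M\<close> need not be the identity, so the
  amalgam has to be renamed.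
\<close>

lemma infinity_AP_over:
  assumes AP: "infinity_AP L K le" and inf: "infinite (UNIV :: 'u set)"
    and I: "small (I :: 'u set)" "I \<noteq> {}" and le: "\<And>i. i \<in> I \<Longrightarrow> le M (N i)"
  obtains P g where "le M P" "\<And>i. i \<in> I \<Longrightarrow> K_embedding L K le (g i) (N i) P"
    "\<And>i x. i \<in> I \<Longrightarrow> x \<in> univ M \<Longrightarrow> g i x = x"
proof -
  obtain j where j: "j \<in> I"
    using I by blast
  have M: "M \<in> K" "is_struct L M"
    using le[OF j] le_in_K structs by blast+
  have "\<forall>i\<in>I. K_embedding L K le id M (N i)"
    using le K_embedding_ident by simp
  then have "\<exists>Q\<in>K. \<exists>g. (\<forall>i\<in>I. K_embedding L K le (g i) (N i) Q) \<and>
      (\<forall>i\<in>I. \<forall>k\<in>I. \<forall>x\<in>univ M. g i (id x) = g k (id x))"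
    using AP[unfolded infinity_AP_def, rule_format, of I M "\<lambda>_. id" N] I(1) M(1) by simp
  then obtain Q g where Q: "Q \<in> K" and all: "\<forall>i\<in>I. K_embedding L K le (g i) (N i) Q"
    "\<forall>i\<in>I. \<forall>k\<in>I. \<forall>x\<in>univ M. g i x = g k x"
    by auto
  have g: "K_embedding L K le (g i) (N i) Q" if "i \<in> I" for i
    using all(1) that by blast
  have eq: "g i x = g k x" if "i \<in> I" "k \<in> I" "x \<in> univ M" for i k x
    using all(2) that by blast
  have MN: "univ M \<subseteq> univ (N i)" if "i \<in> I" for i
    using le_substruct[OF le[OF that]] by (simp add: substruct_def)
  have *: "inj_on (g j) (univ (N j))" "g j ` univ (N j) \<subseteq> univ Q"
    using g[OF j] by (simp_all add: K_embedding_def embedding_def)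
  have gj: "inj_on (g j) (univ M)" "g j ` univ M \<subseteq> univ Q"
    by (rule inj_on_subset[OF *(1) MN[OF j]],
        rule subset_trans[OF image_mono[OF MN[OF j]] *(2)])
  \<comment> \<open>The renaming \<open>s\<close> is prescribed as the inverse of \<open>g j\<close>
    on the copy of \<open>M\<close> inside \<open>Q\<close>, so that it carries this copy back to
    \<open>M\<close>.\<close>
  obtain s where s: "inj_on s (univ Q)"
    and s_inv: "\<And>y. y \<in> g j ` univ M \<Longrightarrow> s y = inv_into (univ M) (g j) y"
    by (rule extend_inj_on_small[OF inf is_structD(1)[OF structs[OF Q]] gj(2)
          inj_on_inv_into[OF subset_refl]]) blast
  have emb: "K_embedding L K le (s \<circ> g i) (N i) (image_struct L s Q)" if "i \<in> I" for i
    using K_embedding_isomorphism[OF g[OF that] s] .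
  \<comment> \<open>All maps \<open>g i\<close> agree with \<open>g j\<close> on \<open>M\<close>,
    so the one renaming built from \<open>g j\<close> serves every index.\<close>
  have fix_M: "(s \<circ> g i) x = x" if "i \<in> I" "x \<in> univ M" for i x
    using eq[OF that(1) j that(2)] s_inv gj(1) that(2) by simp
  have Nj: "is_struct L (N j)" "inj_on (s \<circ> g j) (univ (N j))"
    using emb[OF j] structs unfolding K_embedding_def embedding_def by blast+
  \<comment> \<open>\<open>M\<close> is related to the renamed amalgam by transitivity through the
    image of \<open>N j\<close>; the image of \<open>M\<close> under the same map is
    \<open>M\<close> itself.\<close>
  have "le (image_struct L (s \<circ> g j) M) (image_struct L (s \<circ> g j) (N j))"
    using iso_closed_le[OF le[OF j] is_struct_image_struct[OF Nj(1)] isomorphism_image_struct[OF Nj]]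
    by (rule conjunct2)
  then have "le M (image_struct L (s \<circ> g j) (N j))"
    by (simp only: image_struct_ident[OF M(2) fix_M[OF j]])
  moreover have "le (image_struct L (s \<circ> g j) (N j)) (image_struct L s Q)"
    using emb[OF j] by (simp only: K_embedding_def)
  ultimately have "le M (image_struct L s Q)"
    by (rule le_trans)
  then show thesis
    by (rule that[of _ "\<lambda>i. s \<circ> g i", OF _ emb fix_M])
qed

text \<open>Only as many as \<open>cardSuc lam\<close> types are amalgamated: this already
  contradicts the bound, and it keeps the index set small as \<open>infinity_AP\<close> requires,
  whereas \<open>types_over\<close> ranges over all extensions of \<open>M\<close>.\<close>

lemma infinity_AP_imp_lambda_stable:
  fixes lam :: "'l rel"
  assumes AP: "infinity_AP L K le" and stable: "almost_lambda_stable L K le lam"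
    and lam: "Cinfinite lam" "cardSuc lam <o |UNIV :: 'u set|"
  shows "lambda_stable L K le lam"
  unfolding lambda_stable_def
proof (intro ballI impI)
  fix M assume M: "M \<in> K" "|univ M| =o lam"
  let ?T = "types_over L K le M"
  have co: "Card_order lam" and co': "Cinfinite (cardSuc lam)"
    using lam(1) Cinfinite_cardSuc by auto
  have fld: "|Field (cardSuc lam)| =o cardSuc lam"
    using co' card_of_Field_ordIso by blast
  have le_U: "|Field (cardSuc lam)| \<le>o |UNIV :: 'u set|"
    using ordIso_ordLeq_trans[OF fld ordLess_imp_ordLeq[OF lam(2)]] .
  have inf: "infinite (UNIV :: 'u set)"
    using co' card_of_ordLeq_infinite[OF le_U] by (simp add: cinfinite_def)
  show "|?T| \<le>o lam"
  proof (rule ccontr)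
    assume "\<not> |?T| \<le>o lam"
    then have "cardSuc lam \<le>o |?T|"
      using cardSuc_ordLess_ordLeq[OF co card_of_Card_order]
        not_ordLeq_iff_ordLess_Card_order[OF co card_of_Card_order] by blast
    \<comment> \<open>Indices for \<open>infinity_AP\<close> are points of the universe, so the
      successor cardinal is copied into \<open>'u\<close>.\<close>
    obtain e :: "'l set \<Rightarrow> 'u" where e: "inj_on e (Field (cardSuc lam))"
      using le_U card_of_ordLeq[of "Field (cardSuc lam)" "UNIV :: 'u set"] by auto
    define I where "I = e ` Field (cardSuc lam)"
    have I: "|I| =o cardSuc lam"
      using fld e unfolding I_def
      by (meson bij_betw_imageI card_of_ordIso ordIso_symmetric ordIso_transitive)
    have "|I| \<le>o |?T|"
      using ordIso_ordLeq_trans[OF I \<open>cardSuc lam \<le>o |?T|\<close>] .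
    then obtain t where t: "inj_on t I" "t ` I \<subseteq> ?T"
      using card_of_ordLeq[of I ?T] by auto
    have "\<forall>i\<in>I. \<exists>N c. le M N \<and> c \<in> univ N \<and> t i = ortp L K le c (univ M) N"
      using t(2) unfolding types_over_def types_in_def by blast
    then obtain N c where N: "\<And>i. i \<in> I \<Longrightarrow> le M (N i)"
      and c: "\<And>i. i \<in> I \<Longrightarrow> c i \<in> univ (N i)"
      and tc: "\<And>i. i \<in> I \<Longrightarrow> t i = ortp L K le (c i) (univ M) (N i)"
      by metis
    have "small I"
      using I lam(2) ordIso_ordLess_trans unfolding small_def by blast
    moreover have "I \<noteq> {}"
      using co' unfolding I_def cinfinite_def by auto
    ultimately obtain P g where P: "le M P"
      and g: "\<And>i. i \<in> I \<Longrightarrow> K_embedding L K le (g i) (N i) P"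
      and fix_M: "\<And>i x. i \<in> I \<Longrightarrow> x \<in> univ M \<Longrightarrow> g i x = x"
      using infinity_AP_over[where M = M and N = N, OF AP inf] N by blast
    \<comment> \<open>The realization \<open>c i\<close> of \<open>t i\<close> is moved into
      \<open>P\<close> by \<open>g i\<close>, which preserves its type because \<open>g i\<close>
      fixes \<open>M\<close>.\<close>
    have "t i \<in> types_in L K le M P" if "i \<in> I" for i
    proof -
      have "univ M \<subseteq> univ (N i)"
        using le_substruct[OF N[OF that]] by (simp add: substruct_def)
      then have "t i = ortp L K le (g i (c i)) (univ M) P"
        using ortp_K_embedding[OF g[OF that]] fix_M c tc that by simp
      moreover have "g i (c i) \<in> univ P"
        using g[OF that] c[OF that] unfolding K_embedding_def embedding_def by blast
      ultimately show ?thesis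
        unfolding types_in_def by blast
    qed
    then have "|I| \<le>o |types_in L K le M P|"
      using t(1) card_of_ordLeq by blast
    moreover have "|types_in L K le M P| \<le>o lam"
      using stable M P le_in_K unfolding almost_lambda_stable_def by blast
    ultimately have "cardSuc lam \<le>o lam"
      using I by (meson ordIso_ordLeq_trans ordIso_symmetric ordLeq_transitive)
    then show False
      using not_ordLess_ordLeq[OF cardSuc_greater[OF co]] by contradiction
  qed
qed

end

section \<open>Transfer of orbital types between two orderings\<close>

text \<open>The same amalgam and maps remain witnesses: a \<open>le2\<close>-embedding is a
  \<open>le1\<close>-embedding, and maps fixing \<open>B\<close> pointwise fix
  \<open>A\<close>.\<close>

lemma E_at_restrict:
  assumes refines: "\<And>M N. le2 M N \<Longrightarrow> le1 M N" and "A \<subseteq> B"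
    and E: "((b, B, N), (c, B', P)) \<in> E_at L K le2"
  shows "B' = B" "((b, A, N), (c, A, P)) \<in> E_at L K le1"
proof -
  obtain Q f g where *: "B' = B" "K_embedding L K le2 f N Q" "K_embedding L K le2 g P Q"
    "B \<subseteq> univ N" "B \<subseteq> univ P" "b \<in> univ N" "c \<in> univ P" "f b = g c"
    "\<And>a. a \<in> B \<Longrightarrow> f a = a" "\<And>a. a \<in> B \<Longrightarrow> g a = a"
    using E by (rule E_atE) blast
  show "B' = B"
    by (rule *(1))
  have fg: "K_embedding L K le1 f N Q" "K_embedding L K le1 g P Q"
    using *(2,3) refines unfolding K_embedding_def by simp_all
  show "((b, A, N), (c, A, P)) \<in> E_at L K le1"
    by (rule E_atI[OF fg]) (use * \<open>A \<subseteq> B\<close> in auto)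
qed

text \<open>Along a chain of steps the elements and models vary but the parameter set stays
  \<open>B\<close>; the induction records this so that each step can be restricted to
  \<open>A\<close>.\<close>

lemma trancl_E_at_restrict:
  assumes refines: "\<And>M N. le2 M N \<Longrightarrow> le1 M N" and "A \<subseteq> B"
    and "((b, B, N), q) \<in> (E_at L K le2)\<^sup>+"
  shows "\<exists>c P. q = (c, B, P) \<and> ((b, A, N), (c, A, P)) \<in> (E_at L K le1)\<^sup>+"
  using assms(3)
proof induction
  case (base q)
  obtain c B' P where q: "q = (c, B', P)"
    by (cases q)
  show ?case
    using E_at_restrict[where ?le1.0 = le1, OF refines assms(2) base[unfolded q]] q by auto
next
  case (step q r)
  obtain c P where q: "q = (c, B, P)" "((b, A, N), (c, A, P)) \<in> (E_at L K le1)\<^sup>+"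
    using step.IH by blast
  obtain d B' Q where r: "r = (d, B', Q)"
    by (cases r)
  note E_at_restrict[where ?le1.0 = le1, OF refines assms(2) step.hyps(2)[unfolded q(1) r]]
  then show ?case
    using trancl_into_trancl[OF q(2)] r by simp
qed

text \<open>Within the fixed model \<open>N\<close>, the \<open>le2\<close>-type of an element over
  \<open>M0\<close> determines its \<open>le1\<close>-type over \<open>M\<close>.\<close>

lemma card_of_types_in_mono:
  assumes K1: "abstract_class L K le1" and K2: "abstract_class L K le2"
    and refines: "\<And>M N. le2 M N \<Longrightarrow> le1 M N"
    and M: "univ M \<subseteq> univ M0" and M0: "le2 M0 N"
  shows "|types_in L K le1 M N| \<le>o |types_in L K le2 M0 N|"
proof -
  have N: "N \<in> K" "univ M0 \<subseteq> univ N"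
    using abstract_class.le_in_K[OF K2 M0] abstract_class.le_substruct[OF K2 M0]
    by (auto simp: substruct_def)
  have eq: "ortp L K le1 c (univ M) N = ortp L K le1 d (univ M) N"
    if "d \<in> univ N" "ortp L K le2 c (univ M0) N = ortp L K le2 d (univ M0) N" for c d
  proof -
    have "((c, univ M, N), (d, univ M, N)) \<in> (E_at L K le1)\<^sup>+"
      using trancl_E_at_restrict[where ?le1.0 = le1, OF refines M
          abstract_class.ortp_eqD[OF K2 that(2) N that(1)]] by blast
    then show ?thesis
      by (rule abstract_class.ortp_eqI[OF K1 _ refl refl])
  qed
  show ?thesis
    unfolding types_in_def Setcompr_eq_image by (rule card_of_image_factor) (rule eq)
qed

section \<open>The Loewenheim-Skolem number and the final estimate\<close>

text \<open>Well-foundedness of \<open>ordLess\<close> yields a least suitable cardinal, so the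
  choice in \<open>LS_number\<close> has a witness.\<close>

lemma (in mu_AEC) LS_property_LS_number: "LS_property L K le mu (LS_number L K le mu)"
proof -
  let ?T = "{theta. LS_property L K le mu theta}"
  obtain theta where "theta \<in> ?T"
    using loewenheim_skolem by blast
  then obtain k where k: "k \<in> ?T" and min: "\<And>k'. (k', k) \<in> ordLess \<Longrightarrow> k' \<notin> ?T"
    by (rule wfE_min[OF wf_ordLess]) blast
  have "k \<le>o k'" if "LS_property L K le mu k'" for k'
  proof -
    have "Card_order k" "Card_order k'"
      using k that by (auto simp: LS_property_def)
    then show ?thesis
      using min[of k'] that not_ordLeq_iff_ordLess_Card_order[of k' k] by auto
  qed
  then have "\<exists>theta. LS_property L K le mu theta \<and>
      (\<forall>theta'. LS_property L K le mu theta' \<longrightarrow> theta \<le>o theta')"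
    using k by blast
  from someI_ex[OF this] show ?thesis
    unfolding LS_number_def by (rule conjunct1)
qed

theorem corollary2:
  fixes L :: "('f, 'r, 'i) language"
    and K :: "('u, 'f, 'r, 'i) model set"
    and le1 le2 :: "('u, 'f, 'r, 'i) model \<Rightarrow> ('u, 'f, 'r, 'i) model \<Rightarrow> bool"
    and mu :: "'m rel"
    and lam :: "'l rel"
  assumes mu: "Cinfinite mu" "regularCard mu"
    and K1: "mu_AEC L K le1 mu"
    and K2: "mu_AEC L K le2 mu"
    and refines: "\<And>M N. M \<in> K \<Longrightarrow> N \<in> K \<Longrightarrow> le2 M N \<Longrightarrow> le1 M N"
    and lam: "Cinfinite lam"
      (* lam^+ is a cardinal of the universe played by 'u; in ZFC this holds for every lam *)
      "cardSuc lam <o |UNIV :: 'u set|"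
    and lam_eq: "lam =o cexp_less lam mu +c LS_number L K le2 mu"
    and K2_almost_stable: "almost_lambda_stable L K le2 lam"
  shows "almost_lambda_stable L K le1 lam \<and> (infinity_AP L K le1 \<longrightarrow> lambda_stable L K le1 lam)"
proof -
  interpret K1: mu_AEC L K le1 mu by (rule K1)
  interpret K2: mu_AEC L K le2 mu by (rule K2)
  have "|types_in L K le1 M N| \<le>o lam"
    if N: "N \<in> K" and le: "le1 M N" and card_M: "|univ M| =o lam" for M N
  proof -
    have MN: "univ M \<subseteq> univ N"
      using K1.le_substruct[OF le] by (simp add: substruct_def)
    have "\<forall>N\<in>K. \<forall>A\<subseteq>univ N. \<exists>M0\<in>K. A \<subseteq> univ M0 \<and> le2 M0 N \<and>
        |univ M0| \<le>o cexp_less |A| mu +c LS_number L K le2 mu"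
      using K2.LS_property_LS_number unfolding LS_property_def by (elim conjE)
    then obtain M0 where M0: "M0 \<in> K" "univ M \<subseteq> univ M0" "le2 M0 N"
      "|univ M0| \<le>o cexp_less |univ M| mu +c LS_number L K le2 mu"
      using N MN by meson
    have "cexp_less |univ M| mu \<le>o cexp_less lam mu"
      by (rule cexp_less_mono[OF card_of_Card_order ordIso_imp_ordLeq[OF card_M]])
    then have "cexp_less |univ M| mu +c LS_number L K le2 mu \<le>o lam"
      by (rule ordLeq_ordIso_trans[OF csum_mono1 ordIso_symmetric[OF lam_eq]])
    then have "|univ M0| \<le>o lam"
      by (rule ordLeq_transitive[OF M0(4)])
    \<comment> \<open>The lower bound matters too: almost stability speaks only of models of
      cardinality exactly \<open>lam\<close>.\<close>
    moreover have "lam \<le>o |univ M0|"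
      by (rule ordIso_ordLeq_trans[OF ordIso_symmetric[OF card_M] card_of_mono1[OF M0(2)]])
    ultimately have "|univ M0| =o lam"
      by (simp add: ordIso_iff_ordLeq)
    then have "|types_in L K le2 M0 N| \<le>o lam"
      using K2_almost_stable M0(1,3) N by (simp add: almost_lambda_stable_def)
    moreover have "|types_in L K le1 M N| \<le>o |types_in L K le2 M0 N|"
      by (rule card_of_types_in_mono[OF K1.abstract_class_axioms K2.abstract_class_axioms _ M0(2,3)])
        (use refines K2.le_in_K in blast)
    ultimately show ?thesis
      by (rule ordLeq_transitive[rotated])
  qed
  then have "almost_lambda_stable L K le1 lam"
    by (simp add: almost_lambda_stable_def)
  then show ?thesis
    using K1.infinity_AP_imp_lambda_stable[OF _ _ lam] by simp
qed

end
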